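(* Define, for every integer $r\geqslant 2$, $m(r)=2^{(r+2)/2}-2$ if $r$ is even and $m(r)=5\cdot 2^{(r-3)/2}-2$ if $r$ is odd, and let $m'(r)=8m(r)+14$. For every integer $r\geqslant 2$, every reduced graph of rank $r$ has at most $m'(r)$ vertices.
   Context: All graphs are finite and simple. The rank of a graph is the rank over $\mathbb{R}$ of its adjacency matrix. A graph is reduced if it has no isolated vertices and no two distinct vertices with the same set of neighbors. *)

theory Defs
  imports "HOL-Analysis.Analysis"
begin

text \<open>A finite simple graph is a symmetric irreflexive adjacency relation on a vertex type
  of class \<open>finite\<close>; the vertex set is the whole type. This omits only the graph without vertices,
  whose rank is 0.\<close>

definition simple_graph :: "('v \<Rightarrow> 'v \<Rightarrow> bool) \<Rightarrow> bool" where
  "simple_graph E \<longleftrightarrow> symp E \<and> irreflp E"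

definition neighbors :: "('v \<Rightarrow> 'v \<Rightarrow> bool) \<Rightarrow> 'v \<Rightarrow> 'v set" where
  "neighbors E v = {w. E v w}"

definition reduced_graph :: "('v \<Rightarrow> 'v \<Rightarrow> bool) \<Rightarrow> bool" where
  "reduced_graph E \<longleftrightarrow>
     (\<forall>v. neighbors E v \<noteq> {}) \<and> (\<forall>u v. u \<noteq> v \<longrightarrow> neighbors E u \<noteq> neighbors E v)"

definition adjacency_matrix :: "('v::finite \<Rightarrow> 'v \<Rightarrow> bool) \<Rightarrow> real ^ 'v ^ 'v" where
  "adjacency_matrix E = (\<chi> u v. if E u v then 1 else 0)"

definition graph_rank :: "('v::finite \<Rightarrow> 'v \<Rightarrow> bool) \<Rightarrow> nat" where
  "graph_rank E = rank (adjacency_matrix E)"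

text \<open>The functions \<open>m\<close> and \<open>m'\<close>, meant for \<open>r \<ge> 2\<close>: there both divisions are exact and
  \<open>r - 3\<close> is not truncated, since an odd \<open>r\<close> is at least 3.\<close>

definition m_order :: "nat \<Rightarrow> int" where
  "m_order r = (if even r then 2 ^ ((r + 2) div 2) - 2 else 5 * 2 ^ ((r - 3) div 2) - 2)"

definition m'_order :: "nat \<Rightarrow> int" where
  "m'_order r = 8 * m_order r + 14"

end

theory Submission
  imports Defs
begin

text \<open>Put \<open>F(r) = 10 * sqrt 2 ^ (r + 1)\<close>; by strong induction on \<open>r\<close>, a reduced graph \<open>U\<close> of rank \<open>r\<close> has
  \<open>n \<le> F(r) - 2\<close> vertices. For \<open>r \<le> 7\<close> this follows from \<open>n \<le> 2 ^ r - 1\<close>.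

  Otherwise let \<open>H\<close> be a largest induced subgraph of smaller rank, \<open>S = U - H\<close> and \<open>t = card S\<close>. Deleting
  the symmetric difference of two neighbourhoods lowers the rank, so any two rows of the adjacency matrix
  are at Hamming distance at least \<open>t\<close>. A family of \<open>n\<close> zero-one vectors spanning only \<open>r\<close>
  dimensions cannot be that well separated: if \<open>n\<close> exceeds \<open>F(r) - 2\<close> then \<open>t \<le> 9 n / 32\<close>.
  So \<open>H\<close> is too large to be covered by induction unless it contains twins and has rank exactly \<open>r - 2\<close>.

  Twins in \<open>H\<close> differ on all of \<open>S\<close>, hence come in pairs. With \<open>a\<close> pairs, \<open>b\<close> vertices without
  twin and at most one isolated vertex, \<open>n \<le> t + 1 + 2 a + b\<close> and \<open>a + b \<le> F(r - 2) - 2\<close>, which suffices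
  if \<open>t\<close> is at most about \<open>b\<close>. The pairs are joined to \<open>S\<close> in only one way up to swapping, so the vertices
  of \<open>S\<close> are told apart by the \<open>b\<close> single vertices. The differences of their rows span a space of some
  dimension \<open>q\<close>, so that \<open>t \<le> 2 * 2 ^ q\<close>, while the graph on one vertex of each pair is twin-free of rank
  at most \<open>r - 2 - q\<close>. If \<open>t\<close> exceeds \<open>b\<close>, these facts bound \<open>n\<close> for \<open>q \<le> 2\<close> and force
  \<open>t > 9 n / 32\<close> for \<open>q \<ge> 3\<close>.\<close>

section \<open>Zero-one vectors in low-dimensional spaces\<close>

text \<open>Rank-nullity on \<open>span G\<close>: the orthogonal complement \<open>C\<close> of
  \<open>K\<close> inside \<open>span G\<close> has the same image as \<open>span G\<close>, and its
  dimension is \<open>dim G - dim K\<close>.\<close>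

lemma dim_image_add_kernel_le:
  fixes f :: "'a::euclidean_space \<Rightarrow> 'b::euclidean_space"
  assumes f: "linear f" and K: "subspace K" "K \<subseteq> span G" "\<And>x. x \<in> K \<Longrightarrow> f x = 0"
  shows "dim (f ` G) + dim K \<le> dim G"
proof -
  define C where "C = {y \<in> span G. \<forall>x\<in>K. orthogonal x y}"
  have "f ` G \<subseteq> f ` C"
  proof
    fix w assume "w \<in> f ` G"
    then obtain g where g: "g \<in> span G" "w = f g"
      using span_base by blast
    obtain y z where yz: "y \<in> span K" "\<And>u. u \<in> span K \<Longrightarrow> orthogonal z u" "g = y + z"
      using orthogonal_subspace_decomp_exists[of K g] by blast
    have y: "y \<in> K"
      using yz(1) K(1) by (metis span_eq_iff)
    have "z = g - y"
      using yz(3) by simp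
    then have "z \<in> span G"
      using g(1) y K(2) by (auto intro: span_diff)
    then have "z \<in> C"
      using yz(2) by (auto simp: C_def orthogonal_commute span_base)
    moreover have "w = f z"
      using g(2) yz(3) K(3)[OF y] linear_add[OF f] by simp
    ultimately show "w \<in> f ` C"
      by blast
  qed
  then have "dim (f ` G) \<le> dim (f ` C)"
    by (rule dim_subset)
  also have "\<dots> \<le> dim C"
    by (rule dim_image_le[OF f])
  finally show ?thesis
    using dim_subspace_orthogonal_to_vectors[OF K(1) subspace_span K(2)]
    by (simp add: C_def)
qed

text \<open>Split \<open>B\<close> at a coordinate where two members differ. Differences within
  either half vanish there, but some element of \<open>Q\<close> does not, so induction on the
  dimension bounds both halves. Controlling only differences lets \<open>B\<close> lie in a
  translate of \<open>Q\<close>.\<close>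

lemma card_01_vectors_le:
  fixes B :: "(real^'n) set"
  assumes "\<And>x i. x \<in> B \<Longrightarrow> x $ i = 0 \<or> x $ i = 1"
    and "\<And>x y. x \<in> B \<Longrightarrow> y \<in> B \<Longrightarrow> x - y \<in> Q"
    and "subspace Q" and "dim Q \<le> q"
  shows "card B \<le> 2 ^ q"
  using assms
proof (induction q arbitrary: B Q)
  case 0
  have "Q \<subseteq> {0}"
    using 0(4) dim_eq_0 by blast
  then have "x = y" if "x \<in> B" "y \<in> B" for x y
    using 0(2)[OF that] by auto
  then show ?case
    by (metis card_le_Suc0_iff_eq card.infinite One_nat_def le0 power_0)
next
  case (Suc q)
  show ?case
  proof (cases "\<exists>x\<in>B. \<exists>y\<in>B. x \<noteq> y")
    case False
    then have "card B \<le> 1"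
      by (metis card_le_Suc0_iff_eq card.infinite One_nat_def le0)
    then show ?thesis
      by (metis le_trans one_le_numeral one_le_power)
  next
    case True
    then obtain x y i where xy: "x \<in> B" "y \<in> B" "x $ i \<noteq> y $ i"
      by (auto simp: vec_eq_iff)
    define Q' where "Q' = {w \<in> Q. w $ i = 0}"
    have sub: "subspace Q'"
      using Suc.prems(3) by (auto simp: Q'_def subspace_def)
    have "x - y \<in> Q" "x - y \<notin> Q'"
      using xy Suc.prems(2) by (auto simp: Q'_def)
    moreover have "Q' \<subseteq> Q"
      by (auto simp: Q'_def)
    ultimately have "Q' \<subset> Q"
      by blast
    then have "dim Q' < dim Q"
      by (metis dim_psubset span_eq_iff sub Suc.prems(3))
    then have dim: "dim Q' \<le> q"
      using Suc.prems(4) by simp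
    have part: "card {w \<in> B. w $ i = a} \<le> 2 ^ q" for a
      by (rule Suc.IH[OF _ _ sub dim]) (use Suc.prems(1,2) in \<open>auto simp: Q'_def\<close>)
    have "{w \<in> B. w $ i = 0} \<union> {w \<in> B. w $ i = 1} = B"
      using Suc.prems(1) by auto
    then have "card B \<le> card {w \<in> B. w $ i = 0} + card {w \<in> B. w $ i = 1}"
      using card_Un_le[of "{w \<in> B. w $ i = 0}" "{w \<in> B. w $ i = 1}"] by simp
    then show ?thesis
      using part[of 0] part[of 1] by simp
  qed
qed

section \<open>Coordinates that carry a large share of the energy\<close>

lemma exists_representative_coordinate:
  fixes y :: "'a \<Rightarrow> real^'n"
  assumes "finite U" and L: "subspace L" "0 < dim L" and y: "\<And>v. v \<in> U \<Longrightarrow> y v \<in> L"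
  shows "\<exists>z f. f \<in> L \<and> f \<noteq> 0 \<and> (\<forall>x\<in>L. x \<bullet> f = x $ z) \<and>
    (f \<bullet> f) * (\<Sum>v\<in>U. y v \<bullet> y v) \<le> real (dim L) * (\<Sum>v\<in>U. (y v $ z)\<^sup>2)"
proof -
  obtain B where B: "B \<subseteq> L" "pairwise orthogonal B" "\<And>x. x \<in> B \<Longrightarrow> norm x = 1"
    "independent B" "card B = dim L" "span B = L"
    using orthonormal_basis_subspace[OF L(1)] by metis
  have fin: "finite B"
    using B(4) independent_imp_finite by blast
  \<comment> \<open>\<open>f z\<close> is the orthogonal projection onto \<open>L\<close> of the
    unit vector at \<open>z\<close>.\<close>
  define f where "f z = (\<Sum>e\<in>B. (e $ z) *\<^sub>R e)" for z
  have fL: "f z \<in> L" for z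
    unfolding f_def using B(1) L(1) by (intro subspace_sum) (auto intro: subspace_scale)
  have inner_basis: "a \<bullet> c = (if a = c then 1 else 0)" if "a \<in> B" "c \<in> B" for a c
    using that B(2,3) by (auto simp: pairwise_def orthogonal_def norm_eq_1)
  have rep: "x \<bullet> f z = x $ z" if "x \<in> L" for x z
  proof -
    have "x \<in> span B"
      using that B(6) by simp
    then show ?thesis
    proof (induction rule: span_induct_alt)
      case base
      then show ?case by simp
    next
      case (step c a x)
      have "a \<bullet> f z = (\<Sum>e\<in>B. (e $ z) * (if a = e then 1 else 0))"
        unfolding f_def inner_sum_right using step(1) by (intro sum.cong) (auto simp: inner_basis)
      also have "\<dots> = a $ z"
        using step(1) fin by (simp add: if_distrib cong: if_cong)
      finally show ?case
        using step by (simp add: inner_add_left)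
    qed
  qed
  have ff: "f z \<bullet> f z = (\<Sum>e\<in>B. (e $ z)\<^sup>2)" for z
    using rep[OF fL, of z z] unfolding f_def by (simp add: power2_eq_square)
  have trace: "(\<Sum>z\<in>UNIV. f z \<bullet> f z) = real (dim L)"
  proof -
    have "(\<Sum>z\<in>UNIV. f z \<bullet> f z) = (\<Sum>e\<in>B. \<Sum>z\<in>UNIV. (e $ z)\<^sup>2)"
      unfolding ff by (rule sum.swap)
    also have "\<dots> = (\<Sum>e\<in>B. e \<bullet> e)"
      by (simp add: inner_vec_def power2_eq_square)
    also have "\<dots> = real (card B)"
      by (simp add: inner_basis)
    finally show ?thesis
      using B(5) by simp
  qed
  define E where "E = (\<Sum>v\<in>U. y v \<bullet> y v)"
  have energy: "(\<Sum>z\<in>UNIV. \<Sum>v\<in>U. (y v $ z)\<^sup>2) = E"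
    unfolding E_def by (subst sum.swap) (simp add: inner_vec_def power2_eq_square)
  show ?thesis
  proof (rule ccontr)
    \<comment> \<open>Then the wanted inequality fails wherever \<open>f z\<close> is nonzero, and
      both sides are zero elsewhere; summing over \<open>z\<close> gives
      \<open>dim L * E < dim L * E\<close>.\<close>
    assume "\<not> ?thesis"
    then have less: "real (dim L) * (\<Sum>v\<in>U. (y v $ z)\<^sup>2) < (f z \<bullet> f z) * E" if "f z \<noteq> 0" for z
      using that fL rep unfolding E_def by (meson not_le)
    have eq: "real (dim L) * (\<Sum>v\<in>U. (y v $ z)\<^sup>2) = (f z \<bullet> f z) * E" if "f z = 0" for z
    proof -
      have "y v $ z = 0" if "v \<in> U" for v
        using rep[OF y[OF that], of z] \<open>f z = 0\<close> by simp
      then show ?thesis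
        using that by simp
    qed
    obtain z0 where "f z0 \<noteq> 0"
    proof (rule ccontr)
      assume "\<not> thesis"
      then have "\<And>z. f z = 0"
        using that by blast
      then show False
        using trace L(2) by (simp del: dim_eq_0)
    qed
    have le: "real (dim L) * (\<Sum>v\<in>U. (y v $ z)\<^sup>2) \<le> (f z \<bullet> f z) * E" for z
      using less[of z] eq[of z] by (metis less_imp_le order_refl)
    have "(\<Sum>z\<in>UNIV. real (dim L) * (\<Sum>v\<in>U. (y v $ z)\<^sup>2)) < (\<Sum>z\<in>UNIV. (f z \<bullet> f z) * E)"
      by (rule sum_strict_mono_ex1)
        (use le less[OF \<open>f z0 \<noteq> 0\<close>] in auto)
    then show False
      unfolding sum_distrib_left[symmetric] sum_distrib_right[symmetric] energy trace by simp
  qed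
qed

text \<open>On \<open>L\<close> the functional \<open>x \<mapsto> x $ z\<close> is represented by the projection of the unit vector at \<open>z\<close>.
  The squared norms of these projections sum to \<open>dim L\<close>, so some coordinate carries at least the share
  \<open>1 / dim L\<close> of the energy, and removing its direction costs that share.\<close>
lemma greedy_coordinates:
  fixes b :: "'a \<Rightarrow> real^'n"
  assumes U: "finite U" and W: "subspace W" "dim W \<le> r" "0 < r"
    and b: "\<And>v. v \<in> U \<Longrightarrow> b v \<in> W" and k: "k \<le> r"
  shows "\<exists>Z y L. card Z \<le> k \<and> subspace L \<and> dim L \<le> r - k \<and> (\<forall>v\<in>U. y v \<in> L) \<and>
    real r * (\<Sum>v\<in>U. y v \<bullet> y v) \<le> real (r - k) * (\<Sum>v\<in>U. b v \<bullet> b v) \<and>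
    (\<forall>u\<in>U. \<forall>v\<in>U. (\<forall>z\<in>Z. b u $ z = b v $ z) \<longrightarrow> y u - y v = b u - b v)"
  using k
proof (induction k)
  case 0
  show ?case
    by (rule exI[of _ "{}"], rule exI[of _ b], rule exI[of _ W]) (use W b in auto)
next
  case (Suc k)
  obtain Z y L where IH: "card Z \<le> k" "subspace L" "dim L \<le> r - k" "\<And>v. v \<in> U \<Longrightarrow> y v \<in> L"
    "real r * (\<Sum>v\<in>U. y v \<bullet> y v) \<le> real (r - k) * (\<Sum>v\<in>U. b v \<bullet> b v)"
    "\<And>u v. u \<in> U \<Longrightarrow> v \<in> U \<Longrightarrow> (\<forall>z\<in>Z. b u $ z = b v $ z) \<Longrightarrow> y u - y v = b u - b v"
    using Suc.IH[OF Suc_leD[OF Suc.prems]] by blast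
  show ?case
  proof (cases "0 < dim L")
    case False
    then have "dim L = 0"
      by simp
    then have "y v = 0" if "v \<in> U" for v
      using IH(4)[OF that] dim_eq_0 by blast
    then have "real r * (\<Sum>v\<in>U. y v \<bullet> y v) \<le> real (r - Suc k) * (\<Sum>v\<in>U. b v \<bullet> b v)"
      by (simp add: sum_nonneg)
    moreover have "dim L \<le> r - Suc k"
      using \<open>dim L = 0\<close> by linarith
    ultimately show ?thesis
      using IH by (intro exI[of _ Z] exI[of _ y] exI[of _ L]) (auto simp del: dim_eq_0)
  next
    case True
    then obtain z f where f: "f \<in> L" "f \<noteq> 0" "\<And>x. x \<in> L \<Longrightarrow> x \<bullet> f = x $ z"
      "(f \<bullet> f) * (\<Sum>v\<in>U. y v \<bullet> y v) \<le> real (dim L) * (\<Sum>v\<in>U. (y v $ z)\<^sup>2)"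
      using exists_representative_coordinate[of U L y] U IH(2,4) by blast
    \<comment> \<open>Projecting away \<open>f\<close> makes coordinate \<open>z\<close> vanish,
      costs \<open>(y v $ z)^2 / (f \<bullet> f)\<close> of the squared norm, and preserves
      differences of vectors that agree at \<open>z\<close>.\<close>
    define y' where "y' v = y v - (y v $ z / (f \<bullet> f)) *\<^sub>R f" for v
    define L' where "L' = {x \<in> L. x $ z = 0}"
    have ff: "f \<bullet> f > 0" "f $ z = f \<bullet> f"
      using f(2) f(3)[OF f(1)] inner_gt_zero_iff[of f] by metis+
    have L': "subspace L'"
      using IH(2) by (auto simp: L'_def subspace_def)
    have "f \<notin> L'"
      using ff by (simp add: L'_def)
    moreover have "L' \<subseteq> L"
      by (auto simp: L'_def)
    ultimately have "L' \<subset> L"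
      using f(1) by blast
    then have "dim L' < dim L"
      by (metis dim_psubset span_eq_iff L' IH(2))
    then have dim: "dim L' \<le> r - Suc k"
      using IH(3) by simp
    have y'L: "y' v \<in> L'" if "v \<in> U" for v
      using IH(4)[OF that] f(1) ff IH(2)
      by (auto simp: L'_def y'_def intro!: subspace_diff subspace_scale)
    have norm: "y' v \<bullet> y' v = y v \<bullet> y v - (y v $ z)\<^sup>2 / (f \<bullet> f)" if "v \<in> U" for v
    proof -
      define c where "c = y v $ z / (f \<bullet> f)"
      have "y v \<bullet> f = c * (f \<bullet> f)" "y v $ z = c * (f \<bullet> f)"
        using f(3)[OF IH(4)[OF that]] ff(1) by (simp_all add: c_def)
      moreover have "y' v \<bullet> y' v = y v \<bullet> y v - 2 * c * (y v \<bullet> f) + c * c * (f \<bullet> f)"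
        unfolding y'_def c_def[symmetric]
        by (simp add: inner_diff_left inner_diff_right inner_commute[of f "y v"] algebra_simps)
      ultimately show ?thesis
        using ff(1) by (simp add: power2_eq_square)
    qed
    define S where "S = (\<Sum>v\<in>U. y v \<bullet> y v)"
    define q where "q = (\<Sum>v\<in>U. (y v $ z)\<^sup>2) / (f \<bullet> f)"
    have sum': "(\<Sum>v\<in>U. y' v \<bullet> y' v) = S - q"
      by (simp add: norm sum_subtractf S_def q_def sum_divide_distrib)
    have "S \<le> real (dim L) * q"
      using f(4) ff by (simp add: S_def q_def field_simps)
    also have "\<dots> \<le> real (r - k) * q"
      using IH(3) ff by (intro mult_right_mono) (auto simp: q_def sum_nonneg)
    finally have Sq: "S \<le> real (r - k) * q" .
    have rk: "real (r - k) = real (r - Suc k) + 1" "real (r - k) > 0"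
      using Suc.prems by auto
    have "real (r - k) * (S - q) \<le> real (r - Suc k) * S"
      using Sq rk by (simp add: algebra_simps)
    then have "real r * (real (r - k) * (S - q)) \<le> real r * (real (r - Suc k) * S)"
      by (intro mult_left_mono) auto
    also have "\<dots> = real (r - Suc k) * (real r * S)"
      by simp
    also have "\<dots> \<le> real (r - Suc k) * (real (r - k) * (\<Sum>v\<in>U. b v \<bullet> b v))"
      using IH(5) by (intro mult_left_mono) (auto simp: S_def)
    finally have "real (r - k) * (real r * (S - q)) \<le> real (r - k) * (real (r - Suc k) * (\<Sum>v\<in>U. b v \<bullet> b v))"
      by (simp add: algebra_simps)
    then have energy: "real r * (S - q) \<le> real (r - Suc k) * (\<Sum>v\<in>U. b v \<bullet> b v)"
      using rk(2) by simp
    have eq: "y' u - y' v = b u - b v"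
      if "u \<in> U" "v \<in> U" "\<forall>w\<in>insert z Z. b u $ w = b v $ w" for u v
    proof -
      have *: "y u - y v = b u - b v"
        using IH(6) that by simp
      then have "(y u - y v) $ z = 0"
        using that(3) by simp
      then have "y u $ z = y v $ z"
        by simp
      then show ?thesis
        using * by (simp add: y'_def)
    qed
    have "card (insert z Z) \<le> Suc k"
      using IH(1) by (simp add: card_insert_if)
    then show ?thesis
      using dim L' y'L energy eq sum'
      by (intro exI[of _ "insert z Z"] exI[of _ y'] exI[of _ L']) auto
  qed
qed

text \<open>Sum the squared distances over ordered pairs: the result is \<open>2 * m\<close> times
  the energy minus twice the squared norm of the sum of all vectors.\<close>

lemma card_pred_times_le_energy:
  fixes y :: "'a \<Rightarrow> real^'n"
  assumes P: "finite P" "P \<noteq> {}"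
    and t: "\<And>u v. u \<in> P \<Longrightarrow> v \<in> P \<Longrightarrow> u \<noteq> v \<Longrightarrow> t \<le> (y u - y v) \<bullet> (y u - y v)"
  shows "(real (card P) - 1) * t \<le> 2 * (\<Sum>v\<in>P. y v \<bullet> y v)"
proof -
  define m where "m = real (card P)"
  have m: "m > 0"
    using P by (simp add: m_def card_gt_0_iff)
  have row: "(m - 1) * t \<le> (\<Sum>v\<in>P. (y u - y v) \<bullet> (y u - y v))" if u: "u \<in> P" for u
  proof -
    have "(m - 1) * t = (\<Sum>v\<in>P - {u}. t)"
      using u P by (simp add: m_def card_gt_0_iff of_nat_diff Suc_leI)
    also have "\<dots> \<le> (\<Sum>v\<in>P - {u}. (y u - y v) \<bullet> (y u - y v))"
      using t u by (intro sum_mono) auto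
    also have "\<dots> \<le> (\<Sum>v\<in>P. (y u - y v) \<bullet> (y u - y v))"
      using P by (intro sum_mono2) auto
    finally show ?thesis .
  qed
  have "m * ((m - 1) * t) = (\<Sum>u\<in>P. (m - 1) * t)"
    by (simp add: m_def)
  also have "\<dots> \<le> (\<Sum>u\<in>P. \<Sum>v\<in>P. (y u - y v) \<bullet> (y u - y v))"
    by (intro sum_mono row)
  also have "\<dots> = (\<Sum>u\<in>P. \<Sum>v\<in>P. y u \<bullet> y u + y v \<bullet> y v - 2 * (y u \<bullet> y v))"
    by (simp add: inner_diff_left inner_diff_right inner_commute algebra_simps)
  also have "\<dots> = 2 * m * (\<Sum>v\<in>P. y v \<bullet> y v) - 2 * ((\<Sum>v\<in>P. y v) \<bullet> (\<Sum>v\<in>P. y v))"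
    by (simp add: sum.distrib sum_subtractf m_def inner_sum_left inner_sum_right
        sum_distrib_left[symmetric] sum.swap[of "\<lambda>u v. y v \<bullet> y u"])
  also have "\<dots> \<le> m * (2 * (\<Sum>v\<in>P. y v \<bullet> y v))"
    by simp
  finally show ?thesis
    using m by (simp add: m_def)
qed

text \<open>Vectors with the same pattern on the \<open>k\<close> greedily chosen coordinates differ only in the
  part of small energy; within each of the at most \<open>2 ^ k\<close> patterns, Plotkin's averaging argument applies.\<close>
lemma separated_01_family:
  fixes a :: "'a \<Rightarrow> real^'n"
  assumes U: "finite U"
    and a01: "\<And>v z. v \<in> U \<Longrightarrow> a v $ z = 0 \<or> a v $ z = 1"
    and supp: "\<And>v z. v \<in> U \<Longrightarrow> z \<notin> V \<Longrightarrow> a v $ z = 0"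
    and r: "dim (a ` U) \<le> r" "0 < r" and k: "k \<le> r"
    and t: "0 \<le> t" "\<And>u v. u \<in> U \<Longrightarrow> v \<in> U \<Longrightarrow> u \<noteq> v \<Longrightarrow> t \<le> (a u - a v) \<bullet> (a u - a v)"
  shows "2 * real r * t * (real (card U) - 2 ^ k) \<le> real (r - k) * real (card U) * real (card V)"
proof (cases "U = {}")
  case True
  then show ?thesis
    using t by simp
next
  case False
  define n where "n = real (card U)"
  have n: "n > 0"
    using U False by (simp add: n_def card_gt_0_iff)
  \<comment> \<open>Centring at the mean preserves differences and leaves energy
    \<open>n * (p * (1 - p))\<close>, at most \<open>n / 4\<close>, in a coordinate with mean
    \<open>p\<close>.\<close>
  define c where "c = (1 / n) *\<^sub>R (\<Sum>v\<in>U. a v)"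
  define b where "b v = a v - c" for v
  have cW: "c \<in> span (a ` U)"
    unfolding c_def by (intro span_scale span_sum span_base) auto
  have bW: "b v \<in> span (a ` U)" if "v \<in> U" for v
    using span_diff[OF span_base[of "a v" "a ` U"] cW] that by (simp add: b_def)
  have coord: "(\<Sum>v\<in>U. (b v $ z)\<^sup>2) \<le> (if z \<in> V then n / 4 else 0)" for z
  proof -
    define p where "p = c $ z"
    have p: "(\<Sum>v\<in>U. a v $ z) = n * p"
      using n by (simp add: p_def c_def)
    have "(\<Sum>v\<in>U. (b v $ z)\<^sup>2) = (\<Sum>v\<in>U. (1 - 2 * p) * (a v $ z) + p\<^sup>2)"
    proof (rule sum.cong[OF refl])
      fix v assume "v \<in> U"
      then have "a v $ z = 0 \<or> a v $ z = 1"
        by (rule a01)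
      then show "(b v $ z)\<^sup>2 = (1 - 2 * p) * (a v $ z) + p\<^sup>2"
        by (auto simp: b_def p_def power2_eq_square algebra_simps)
    qed
    also have "\<dots> = (1 - 2 * p) * (n * p) + n * p\<^sup>2"
      by (simp add: sum.distrib sum_distrib_left[symmetric] p n_def)
    also have "\<dots> = n * (p * (1 - p))"
      by (simp add: power2_eq_square algebra_simps)
    finally have eq: "(\<Sum>v\<in>U. (b v $ z)\<^sup>2) = n * (p * (1 - p))" .
    show ?thesis
    proof (cases "z \<in> V")
      case True
      have "0 \<le> (p - 1 / 2)\<^sup>2"
        by simp
      then have "p * (1 - p) \<le> 1 / 4"
        by (simp add: power2_eq_square algebra_simps)
      then have "n * (p * (1 - p)) \<le> n * (1 / 4)"
        using n by (intro mult_left_mono) auto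
      then show ?thesis
        using True eq by simp
    next
      case False
      then have "n * p = 0"
        using p supp by simp
      then show ?thesis
        using eq False n by simp
    qed
  qed
  have "(\<Sum>v\<in>U. b v \<bullet> b v) = (\<Sum>z\<in>UNIV. \<Sum>v\<in>U. (b v $ z)\<^sup>2)"
    by (subst sum.swap) (simp add: inner_vec_def power2_eq_square)
  also have "\<dots> \<le> (\<Sum>z\<in>UNIV. if z \<in> V then n / 4 else 0)"
    by (intro sum_mono coord)
  also have "\<dots> = real (card V) * n / 4"
    by (simp add: sum.If_cases)
  finally have E0: "(\<Sum>v\<in>U. b v \<bullet> b v) \<le> real (card V) * n / 4" .
  have "dim (span (a ` U)) \<le> r"
    using r(1) by simp
  from greedy_coordinates[where b = b, OF U subspace_span this r(2) bW k]
  obtain Z y where Z: "card Z \<le> k"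
    and y: "real r * (\<Sum>v\<in>U. y v \<bullet> y v) \<le> real (r - k) * (\<Sum>v\<in>U. b v \<bullet> b v)"
    "\<And>u v. u \<in> U \<Longrightarrow> v \<in> U \<Longrightarrow> (\<forall>z\<in>Z. b u $ z = b v $ z) \<Longrightarrow> y u - y v = b u - b v"
    by blast
  define \<pi> where "\<pi> v = {z \<in> Z. a v $ z = 1}" for v
  have agree: "y u - y v = a u - a v" if "u \<in> U" "v \<in> U" "\<pi> u = \<pi> v" for u v
  proof -
    have "a u $ z = a v $ z" if "z \<in> Z" for z
    proof -
      have "z \<in> \<pi> u \<longleftrightarrow> z \<in> \<pi> v"
        using \<open>\<pi> u = \<pi> v\<close> by simp
      then show ?thesis
        using a01[OF \<open>u \<in> U\<close>, of z] a01[OF \<open>v \<in> U\<close>, of z] that by (auto simp: \<pi>_def)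
    qed
    then show ?thesis
      using y(2)[OF that(1,2)] by (simp add: b_def)
  qed
  have "\<pi> ` U \<subseteq> Pow Z"
    by (auto simp: \<pi>_def)
  then have "card (\<pi> ` U) \<le> 2 ^ card Z"
    by (metis card_Pow card_mono finite finite_Pow_iff)
  also have "\<dots> \<le> 2 ^ k"
    using Z by (intro power_increasing) auto
  finally have classes: "real (card (\<pi> ` U)) \<le> 2 ^ k"
    by (metis of_nat_le_iff of_nat_numeral of_nat_power)
  have "(n - 2 ^ k) * t \<le> (n - real (card (\<pi> ` U))) * t"
    using classes t(1) by (intro mult_right_mono) auto
  also have "\<dots> = (\<Sum>p\<in>\<pi> ` U. (real (card {v \<in> U. \<pi> v = p}) - 1) * t)"
  proof -
    have "card U = (\<Sum>p\<in>\<pi> ` U. card {v \<in> U. \<pi> v = p})"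
      using sum.image_gen[OF U, of "\<lambda>_. 1::nat" \<pi>] by simp
    then have "n = (\<Sum>p\<in>\<pi> ` U. real (card {v \<in> U. \<pi> v = p}))"
      by (simp add: n_def)
    then show ?thesis
      by (simp add: sum_distrib_right[symmetric] sum_subtractf)
  qed
  also have "\<dots> \<le> (\<Sum>p\<in>\<pi> ` U. 2 * (\<Sum>v\<in>{v \<in> U. \<pi> v = p}. y v \<bullet> y v))"
  proof (rule sum_mono)
    fix p assume "p \<in> \<pi> ` U"
    then show "(real (card {v \<in> U. \<pi> v = p}) - 1) * t \<le> 2 * (\<Sum>v\<in>{v \<in> U. \<pi> v = p}. y v \<bullet> y v)"
      using U t(2) agree by (intro card_pred_times_le_energy) auto
  qed
  also have "\<dots> = 2 * (\<Sum>v\<in>U. y v \<bullet> y v)"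
    by (simp add: sum_distrib_left[symmetric] sum.image_gen[OF U, of "\<lambda>v. y v \<bullet> y v" \<pi>, symmetric])
  finally have "real r * ((n - 2 ^ k) * t) \<le> real r * (2 * (\<Sum>v\<in>U. y v \<bullet> y v))"
    by (intro mult_left_mono) auto
  also have "\<dots> \<le> 2 * (real (r - k) * (\<Sum>v\<in>U. b v \<bullet> b v))"
    using y(1) by simp
  also have "\<dots> \<le> 2 * (real (r - k) * (real (card V) * n / 4))"
    using E0 by (intro mult_left_mono) auto
  finally show ?thesis
    by (simp add: n_def algebra_simps)
qed

section \<open>Ranks of induced subgraphs\<close>

locale fin_graph =
  fixes E :: "'v::finite \<Rightarrow> 'v \<Rightarrow> bool"
  assumes sym: "E u v \<longleftrightarrow> E v u" and irrefl [simp]: "\<not> E v v"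
begin

text \<open>Rows are padded with zeros to the full index type, so that rows for different vertex
  sets lie in one space.\<close>

definition nrow :: "'v set \<Rightarrow> 'v \<Rightarrow> real^'v" where
  "nrow Y v = (\<chi> w. of_bool (w \<in> Y \<and> E v w))"

definition subrank :: "'v set \<Rightarrow> 'v set \<Rightarrow> nat" where
  "subrank X Y = dim (nrow Y ` X)"

abbreviation rk :: "'v set \<Rightarrow> nat" where
  "rk U \<equiv> subrank U U"

definition nbrs :: "'v set \<Rightarrow> 'v \<Rightarrow> 'v set" where
  "nbrs U v = {w \<in> U. E v w}"

definition nbr_diff :: "'v set \<Rightarrow> 'v \<Rightarrow> 'v \<Rightarrow> 'v set" where
  "nbr_diff U u v = {w \<in> U. E u w \<noteq> E v w}"

definition reduced :: "'v set \<Rightarrow> bool" where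
  "reduced U \<longleftrightarrow> (\<forall>v\<in>U. nbrs U v \<noteq> {}) \<and> inj_on (nbrs U) U"

definition restr :: "'v set \<Rightarrow> real^'v \<Rightarrow> real^'v" where
  "restr W x = (\<chi> w. if w \<in> W then x $ w else 0)"

lemma nrow_nth [simp]: "nrow Y v $ w = of_bool (w \<in> Y \<and> E v w)"
  by (simp add: nrow_def)

lemma linear_restr: "linear (restr W)"
  by (rule linearI) (auto simp: restr_def vec_eq_iff)

lemma restr_nrow: "W \<subseteq> Y \<Longrightarrow> restr W (nrow Y v) = nrow W v"
  by (auto simp: restr_def vec_eq_iff)

lemma restr_image_nrow: "W \<subseteq> Y \<Longrightarrow> restr W ` nrow Y ` X = nrow W ` X"
  by (simp add: image_image restr_nrow)

text \<open>Row rank equals column rank for \<open>M\<close>, whose columns are again rows of the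
  graph because adjacency is symmetric.\<close>

lemma subrank_commute: "subrank X Y = subrank Y X"
proof -
  define M :: "real^'v^'v" where "M = (\<chi> u w. of_bool (u \<in> X \<and> w \<in> Y \<and> E u w))"
  have row: "row u M = (if u \<in> X then nrow Y u else 0)" for u
    by (auto simp: row_def M_def vec_eq_iff)
  have column: "column w M = (if w \<in> Y then nrow X w else 0)" for w
    by (auto simp: column_def M_def vec_eq_iff sym)
  have "span (rows M) = span (nrow Y ` X)"
  proof (rule span_eq[THEN iffD2], intro conjI subsetI)
    fix g assume "g \<in> rows M"
    then obtain u where "g = (if u \<in> X then nrow Y u else 0)"
      using row by (auto simp: rows_def)
    then show "g \<in> span (nrow Y ` X)"
      by (simp add: span_base span_zero)
  next
    fix g assume "g \<in> nrow Y ` X"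
    then obtain u where "u \<in> X" "g = row u M"
      using row by auto
    then show "g \<in> span (rows M)"
      by (auto simp: rows_def intro!: span_base)
  qed
  moreover have "span (columns M) = span (nrow X ` Y)"
  proof (rule span_eq[THEN iffD2], intro conjI subsetI)
    fix g assume "g \<in> columns M"
    then obtain u where "g = (if u \<in> Y then nrow X u else 0)"
      using column by (auto simp: columns_def)
    then show "g \<in> span (nrow X ` Y)"
      by (simp add: span_base span_zero)
  next
    fix g assume "g \<in> nrow X ` Y"
    then obtain u where "u \<in> Y" "g = column u M"
      using column by auto
    then show "g \<in> span (columns M)"
      by (auto simp: columns_def intro!: span_base)
  qed
  ultimately show ?thesis
    unfolding subrank_def by (metis dim_span row_rank_def column_rank_def)
qed

section \<open>Vertex deletions that lower the rank\<close>

lemma subrank_mono: "X \<subseteq> X' \<Longrightarrow> Y \<subseteq> Y' \<Longrightarrow> subrank X Y \<le> subrank X' Y'"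
  by (metis (no_types) subrank_def subrank_commute dim_subset image_mono le_trans)

text \<open>Restriction to the columns \<open>W\<close> kills the line spanned by \<open>g\<close>,
  so rank-nullity gives the loss.\<close>

lemma subrank_less:
  assumes "W \<subseteq> Y" "g \<in> span (nrow Y ` X)" "g \<noteq> 0" "\<And>i. i \<in> W \<Longrightarrow> g $ i = 0"
  shows "subrank X W + 1 \<le> subrank X Y"
proof -
  have "restr W g = 0"
    using assms(4) by (simp add: restr_def vec_eq_iff)
  then have zero: "restr W x = 0" if "x \<in> span {g}" for x
    using that linear_scale[OF linear_restr] by (auto simp: span_singleton)
  have "span {g} \<subseteq> span (nrow Y ` X)"
    using assms(2) by (simp add: span_minimal)
  then have "dim (restr W ` nrow Y ` X) + dim (span {g}) \<le> dim (nrow Y ` X)"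
    by (intro dim_image_add_kernel_le linear_restr subspace_span zero)
  moreover have "dim (span {g}) = 1"
    using assms(3) by (simp add: dim_insert)
  ultimately show ?thesis
    by (simp add: subrank_def restr_image_nrow[OF assms(1)])
qed

lemma rk_less:
  assumes "W \<subseteq> U" "g \<in> span (nrow U ` U)" "g \<noteq> 0" "\<And>i. i \<in> W \<Longrightarrow> g $ i = 0"
  shows "rk W + 1 \<le> rk U"
  using subrank_less[OF assms] subrank_mono[OF assms(1) order_refl, of W] by linarith

text \<open>If the vanishing combination uses rows of \<open>W\<close> only, then by symmetry both the rows and
  the columns outside \<open>W\<close> contribute to the rank.\<close>
lemma rk_less2:
  assumes "W \<subseteq> U" "g \<in> span (nrow U ` W)" "g \<noteq> 0" "\<And>i. i \<in> W \<Longrightarrow> g $ i = 0"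
  shows "rk W + 2 \<le> rk U"
proof -
  have "g \<in> span (nrow U ` U)"
    using assms(1,2) by (meson image_mono span_mono subsetD)
  then have "subrank U W + 1 \<le> rk U"
    using subrank_less assms by blast
  moreover have "rk W + 1 \<le> subrank W U"
    using subrank_less assms by blast
  ultimately show ?thesis
    by (simp add: subrank_commute)
qed

lemma rk_Diff_nbr_diff:
  assumes "u \<in> U" "v \<in> U" "nbr_diff U u v \<noteq> {}"
  shows "rk (U - nbr_diff U u v) + 1 \<le> rk U"
proof (rule rk_less[where g = "nrow U u - nrow U v"])
  show "nrow U u - nrow U v \<noteq> 0"
    using assms(3) by (auto simp: nbr_diff_def vec_eq_iff)
qed (use assms in \<open>auto simp: nbr_diff_def intro!: span_diff intro: span_base\<close>)

text \<open>Nonadjacent \<open>u\<close> and \<open>v\<close> both lie outside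
  \<open>nbr_diff U u v\<close>, so their rows survive the deletion and \<open>rk_less2\<close>
  applies.\<close>

lemma rk_Diff_nbr_diff_nonadjacent:
  assumes "u \<in> U" "v \<in> U" "\<not> E u v" "nbr_diff U u v \<noteq> {}"
  shows "rk (U - nbr_diff U u v) + 2 \<le> rk U"
proof (rule rk_less2[where g = "nrow U u - nrow U v"])
  have "u \<in> U - nbr_diff U u v" "v \<in> U - nbr_diff U u v"
    using assms sym by (auto simp: nbr_diff_def)
  then show "nrow U u - nrow U v \<in> span (nrow U ` (U - nbr_diff U u v))"
    by (intro span_diff) (auto intro: span_base)
  show "nrow U u - nrow U v \<noteq> 0"
    using assms(4) by (auto simp: nbr_diff_def vec_eq_iff)
qed (auto simp: nbr_diff_def)

lemma rk_Diff_nbrs: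
  assumes "v \<in> U" "nbrs U v \<noteq> {}"
  shows "rk (U - nbrs U v) + 2 \<le> rk U"
proof (rule rk_less2[where g = "nrow U v"])
  have "v \<in> U - nbrs U v"
    using assms by (auto simp: nbrs_def)
  then show "nrow U v \<in> span (nrow U ` (U - nbrs U v))"
    by (auto intro: span_base)
  show "nrow U v \<noteq> 0"
    using assms(2) by (auto simp: nbrs_def vec_eq_iff)
qed (auto simp: nbrs_def)

lemma nbrs_eq_iff: "nbrs W u = nbrs W v \<longleftrightarrow> (\<forall>w\<in>W. E u w \<longleftrightarrow> E v w)"
  by (auto simp: nbrs_def)

lemma nrow_eq_iff: "nrow U u = nrow U v \<longleftrightarrow> nbrs U u = nbrs U v"
  by (auto simp: vec_eq_iff nbrs_def)

text \<open>The zero vector joins the distinct nonzero rows, which accounts for the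
  \<open>+ 1\<close>.\<close>

lemma reduced_card_le:
  assumes "reduced U"
  shows "card U + 1 \<le> 2 ^ rk U"
proof -
  have inj: "inj_on (nrow U) U"
    using assms by (auto simp: reduced_def inj_on_def nrow_eq_iff)
  have nz: "0 \<notin> nrow U ` U"
    using assms by (force simp: reduced_def nbrs_def vec_eq_iff)
  have "card (insert 0 (nrow U ` U)) \<le> 2 ^ rk U"
  proof (rule card_01_vectors_le[where Q = "span (nrow U ` U)"])
    show "x - y \<in> span (nrow U ` U)"
      if "x \<in> insert 0 (nrow U ` U)" "y \<in> insert 0 (nrow U ` U)" for x y
      using that by (intro span_diff) (auto intro: span_base span_zero)
  qed (auto simp: subrank_def)
  then show ?thesis
    using nz by (simp add: card_image[OF inj])
qed

lemma inner_nrow_diff: "(nrow U u - nrow U v) \<bullet> (nrow U u - nrow U v) = real (card (nbr_diff U u v))"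
proof -
  have "(nrow U u - nrow U v) \<bullet> (nrow U u - nrow U v) = (\<Sum>w\<in>UNIV. of_bool (w \<in> nbr_diff U u v))"
    unfolding inner_vec_def by (intro sum.cong) (auto simp: nbr_diff_def)
  then show ?thesis
    by (simp add: of_bool_def sum.If_cases)
qed

lemma min_distance_le:
  assumes "0 < rk U" "k \<le> rk U"
    and "\<And>u v. u \<in> U \<Longrightarrow> v \<in> U \<Longrightarrow> u \<noteq> v \<Longrightarrow> t \<le> card (nbr_diff U u v)"
  shows "2 * real (rk U) * real t * (real (card U) - 2 ^ k) \<le> real (rk U - k) * real (card U) * real (card U)"
  by (rule separated_01_family[where a = "nrow U"])
    (use assms in \<open>auto simp: subrank_def inner_nrow_diff\<close>)

text \<open>Take one vertex from each twin class of non-isolated vertices. A neighbour can be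
  replaced by its representative, so inclusions between neighbourhoods in \<open>U'\<close> lift to
  \<open>W\<close>, and no new twins or isolated vertices arise.\<close>

lemma exists_reduced_representatives:
  obtains U' where "U' \<subseteq> W" "reduced U'" "card U' = card (nbrs W ` {v \<in> W. nbrs W v \<noteq> {}})"
proof -
  define A where "A = {v \<in> W. nbrs W v \<noteq> {}}"
  define U' where "U' = inv_into A (nbrs W) ` nbrs W ` A"
  have sub: "U' \<subseteq> A"
    by (auto simp: U'_def intro: inv_into_into)
  have rep: "\<exists>v'\<in>U'. nbrs W v' = nbrs W v" if "v \<in> A" for v
    using that by (auto simp: U'_def f_inv_into_f)
  have inj: "inj_on (nbrs W) U'"
    by (auto simp: U'_def inj_on_def f_inv_into_f)
  have card: "card U' = card (nbrs W ` A)"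
    unfolding U'_def by (rule card_image) (rule inj_on_inv_into, simp)
  have hit: "\<exists>w'\<in>U'. E u w' \<and> nbrs W w' = nbrs W w" if "u \<in> W" "w \<in> nbrs W u" for u w
  proof -
    have "u \<in> nbrs W w" "w \<in> W"
      using that sym by (auto simp: nbrs_def)
    then have "w \<in> A"
      by (auto simp: A_def)
    then obtain w' where "w' \<in> U'" "nbrs W w' = nbrs W w"
      using rep by blast
    then show ?thesis
      using \<open>u \<in> nbrs W w\<close> sym by (auto simp: nbrs_def)
  qed
  have le: "nbrs W u \<subseteq> nbrs W v" if "u \<in> U'" "v \<in> U'" "nbrs U' u \<subseteq> nbrs U' v" for u v
  proof
    fix w assume w: "w \<in> nbrs W u"
    have "u \<in> W"
      using that(1) sub by (auto simp: A_def)
    then obtain w' where w': "w' \<in> U'" "E u w'" "nbrs W w' = nbrs W w"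
      using hit w by blast
    then have "E v w'"
      using that(3) by (auto simp: nbrs_def)
    then have "v \<in> nbrs W w"
      using that(2) sub w'(3) sym by (auto simp: nbrs_def A_def)
    then show "w \<in> nbrs W v"
      using w sym by (auto simp: nbrs_def)
  qed
  have "reduced U'"
    unfolding reduced_def
  proof
    show "\<forall>v\<in>U'. nbrs U' v \<noteq> {}"
    proof
      fix v assume "v \<in> U'"
      then have "v \<in> W" "nbrs W v \<noteq> {}"
        using sub by (auto simp: A_def)
      then show "nbrs U' v \<noteq> {}"
        using hit by (fastforce simp: nbrs_def[of U'])
    qed
    show "inj_on (nbrs U') U'"
      by (rule inj_onI) (metis inj inj_onD le order_refl subset_antisym)
  qed
  then show thesis
    using that[of U'] sub card by (auto simp: A_def)
qed

end

section \<open>Largest induced subgraphs of smaller rank\<close>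

definition order_bound :: "nat \<Rightarrow> real" where
  "order_bound r = 10 * sqrt 2 ^ (r + 1)"

lemma order_bound_add2: "order_bound (r + 2) = 2 * order_bound r"
  by (simp add: order_bound_def)

lemma order_bound_mono: "r \<le> r' \<Longrightarrow> order_bound r \<le> order_bound r'"
  by (simp add: order_bound_def power_increasing)

lemma (in fin_graph) card_classes_le:
  assumes IH: "\<And>U'. reduced U' \<Longrightarrow> rk U' < r \<Longrightarrow> real (card U') + 2 \<le> order_bound (rk U')"
    and "rk W \<le> r'" "r' < r"
  shows "real (card (nbrs W ` {v \<in> W. nbrs W v \<noteq> {}})) + 2 \<le> order_bound r'"
proof -
  obtain U' where U': "U' \<subseteq> W" "reduced U'" "card U' = card (nbrs W ` {v \<in> W. nbrs W v \<noteq> {}})"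
    by (rule exists_reduced_representatives)
  have "rk U' \<le> r'"
    using subrank_mono[OF U'(1) U'(1)] assms(2) by linarith
  then show ?thesis
    using IH[OF U'(2)] U'(3) assms(3) order_bound_mono[of "rk U'" r'] by fastforce
qed

text \<open>A twin-free graph may still have one isolated vertex, hence \<open>+ 1\<close> in place
  of \<open>+ 2\<close>.\<close>

lemma (in fin_graph) card_twin_free_le:
  assumes IH: "\<And>U'. reduced U' \<Longrightarrow> rk U' < r \<Longrightarrow> real (card U') + 2 \<le> order_bound (rk U')"
    and "rk W \<le> r'" "r' < r" and inj: "inj_on (nbrs W) W"
  shows "real (card W) + 1 \<le> order_bound r'"
proof -
  have "W \<subseteq> {v \<in> W. nbrs W v \<noteq> {}} \<union> {v \<in> W. nbrs W v = {}}"
    by blast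
  then have "card W \<le> card {v \<in> W. nbrs W v \<noteq> {}} + card {v \<in> W. nbrs W v = {}}"
    by (meson card_Un_le card_mono finite le_trans)
  moreover have "card {v \<in> W. nbrs W v = {}} \<le> 1"
    using inj by (auto simp: card_le_Suc0_iff_eq inj_on_def)
  moreover have "card (nbrs W ` {v \<in> W. nbrs W v \<noteq> {}}) = card {v \<in> W. nbrs W v \<noteq> {}}"
    by (intro card_image inj_on_subset[OF inj]) auto
  ultimately show ?thesis
    using card_classes_le[of r W r'] assms by fastforce
qed

section \<open>Consequences of maximality for twins and isolated vertices\<close>

locale maximal_deficient = fin_graph +
  fixes U H :: "'a set"
  assumes reduced: "reduced U" and HU: "H \<subseteq> U" and rkH: "rk H < rk U"
    and maximal: "\<And>W. W \<subseteq> U \<Longrightarrow> rk W < rk U \<Longrightarrow> card W \<le> card H"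
begin

definition "S = U - H"

lemma card_U: "card U = card S + card H"
  using HU by (simp add: S_def card_Diff_subset card_mono)

lemma S_nonempty: "S \<noteq> {}"
  using HU rkH by (auto simp: S_def)

lemma card_S_le:
  assumes "D \<subseteq> U" "rk (U - D) < rk U"
  shows "card S \<le> card D"
  using maximal[of "U - D"] assms card_U card_mono[OF finite assms(1)]
  by (simp add: card_Diff_subset)

lemma nbr_diff_nonempty: "u \<in> U \<Longrightarrow> v \<in> U \<Longrightarrow> u \<noteq> v \<Longrightarrow> nbr_diff U u v \<noteq> {}"
  using reduced by (auto simp: reduced_def inj_on_def nbr_diff_def nbrs_eq_iff)

lemma card_S_le_nbr_diff:
  assumes "u \<in> U" "v \<in> U" "u \<noteq> v"
  shows "card S \<le> card (nbr_diff U u v)"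
  using card_S_le[of "nbr_diff U u v"] rk_Diff_nbr_diff[OF assms(1,2) nbr_diff_nonempty[OF assms]]
  by (auto simp: nbr_diff_def)

lemma nbr_diff_eq_S:
  assumes "u \<in> U" "v \<in> U" "u \<noteq> v" "nbr_diff U u v \<subseteq> S"
  shows "nbr_diff U u v = S"
  using card_S_le_nbr_diff[OF assms(1-3)] assms(4) by (simp add: card_seteq)

text \<open>Deleting the nonempty neighbourhood of \<open>z\<close> lowers the rank, so it has at
  least \<open>card S\<close> elements; lying inside \<open>S\<close>, it fills it.\<close>

lemma isolated_nbrs:
  assumes "z \<in> H" "nbrs H z = {}"
  shows "nbrs U z = S"
proof -
  have z: "z \<in> U"
    using assms(1) HU by blast
  then have "nbrs U z \<noteq> {}"
    using reduced by (simp add: reduced_def)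
  then have "card S \<le> card (nbrs U z)"
    using card_S_le[of "nbrs U z"] rk_Diff_nbrs[OF z] by (auto simp: nbrs_def)
  moreover have "nbrs U z \<subseteq> S"
    using assms(2) by (auto simp: nbrs_def S_def)
  ultimately show ?thesis
    by (simp add: card_seteq)
qed

lemma card_isolated_le: "card {z \<in> H. nbrs H z = {}} \<le> 1"
proof -
  have "z = z'" if "z \<in> H" "z' \<in> H" "nbrs H z = {}" "nbrs H z' = {}" for z z'
    using that isolated_nbrs reduced HU by (metis reduced_def inj_onD subsetD)
  then show ?thesis
    by (auto simp: card_le_Suc0_iff_eq)
qed

lemma twins_nbr_diff:
  assumes "x \<in> H" "y \<in> H" "x \<noteq> y" "nbrs H x = nbrs H y"
  shows "nbr_diff U x y = S"
  by (rule nbr_diff_eq_S) (use assms HU in \<open>auto simp: nbr_diff_def nbrs_eq_iff S_def\<close>)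

lemma twins_S:
  assumes "x \<in> H" "y \<in> H" "x \<noteq> y" "nbrs H x = nbrs H y" "s \<in> S"
  shows "E y s \<longleftrightarrow> \<not> E x s"
  using twins_nbr_diff[OF assms(1-4)] assms(5) by (auto simp: nbr_diff_def)

lemma twins_rk:
  assumes "x \<in> H" "y \<in> H" "x \<noteq> y" "nbrs H x = nbrs H y"
  shows "rk H + 2 \<le> rk U"
proof -
  have "\<not> E x y"
    using assms by (metis irrefl nbrs_eq_iff)
  moreover have "U - S = H"
    using HU by (auto simp: S_def)
  ultimately show ?thesis
    using rk_Diff_nbr_diff_nonadjacent[of x U y] twins_nbr_diff[OF assms] assms HU S_nonempty by auto
qed

text \<open>At a vertex of \<open>S\<close>, three mutual twins would have pairwise opposite
  adjacencies, impossible with two truth values.\<close>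

lemma no_triplets:
  assumes "x \<in> H" "y \<in> H" "z \<in> H" "nbrs H x = nbrs H y" "nbrs H y = nbrs H z"
  shows "x = y \<or> y = z \<or> x = z"
proof (rule ccontr)
  assume *: "\<not> ?thesis"
  obtain s where "s \<in> S"
    using S_nonempty by blast
  then have "E y s \<longleftrightarrow> \<not> E x s" "E z s \<longleftrightarrow> \<not> E y s" "E z s \<longleftrightarrow> \<not> E x s"
    using twins_S * assms by metis+
  then show False
    by blast
qed

lemma card_H_le: "card H \<le> 2 * card (nbrs H ` {v \<in> H. nbrs H v \<noteq> {}}) + 1"
proof -
  define A where "A = {v \<in> H. nbrs H v \<noteq> {}}"
  have fiber: "card {v \<in> A. nbrs H v = i} \<le> 2" for i
  proof (rule ccontr)
    assume "\<not> ?thesis"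
    then have "3 \<le> card {v \<in> A. nbrs H v = i}"
      by simp
    then obtain T where "T \<subseteq> {v \<in> A. nbrs H v = i}" "card T = 3"
      by (rule obtain_subset_with_card_n)
    then obtain a b c where abc: "a \<noteq> b" "b \<noteq> c" "a \<noteq> c"
      "a \<in> A" "b \<in> A" "c \<in> A" "nbrs H a = i" "nbrs H b = i" "nbrs H c = i"
      by (auto simp: card_3_iff)
    then show False
      using no_triplets[of a b c] by (simp add: A_def)
  qed
  have "card A = (\<Sum>i\<in>nbrs H ` A. card {v \<in> A. nbrs H v = i})"
    using sum.image_gen[of A "\<lambda>_. 1::nat" "nbrs H"] by simp
  also have "\<dots> \<le> (\<Sum>i\<in>nbrs H ` A. 2)"
    by (intro sum_mono fiber)
  finally have "card A \<le> 2 * card (nbrs H ` A)"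
    by simp
  moreover have "card H \<le> card A + card {z \<in> H. nbrs H z = {}}"
  proof -
    have "A \<union> {z \<in> H. nbrs H z = {}} = H"
      by (auto simp: A_def)
    then show ?thesis
      using card_Un_le[of A "{z \<in> H. nbrs H z = {}}"] by simp
  qed
  ultimately show ?thesis
    using card_isolated_le by (simp add: A_def)
qed

end

section \<open>Rigidity when twins occur and the rank drops by exactly two\<close>

locale twin_extremal = maximal_deficient +
  fixes x y :: 'a
  assumes xy: "x \<in> H" "y \<in> H" "x \<noteq> y" "nbrs H x = nbrs H y" and rk_eq: "rk H + 2 = rk U"
begin

lemma S_xy: "s \<in> S \<Longrightarrow> E y s \<longleftrightarrow> \<not> E x s"
  using twins_S xy by blast

lemma SU: "S \<subseteq> U"
  by (auto simp: S_def)

lemma twins_coordinate: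
  assumes "g \<in> span (nrow U ` H)" "u \<in> H" "v \<in> H" "nbrs H u = nbrs H v"
  shows "g $ u = g $ v"
proof -
  have "nrow U h $ u = nrow U h $ v" if "h \<in> H" for h
    using that assms(2-4) HU sym by (auto simp: nbrs_def set_eq_iff)
  then have "nrow U ` H \<subseteq> {g. g $ u = g $ v}"
    by auto
  moreover have "subspace {g :: real^'a. g $ u = g $ v}"
    by (auto simp: subspace_def)
  ultimately show ?thesis
    using assms(1) span_minimal by blast
qed

lemma isolated_coordinate:
  assumes "g \<in> span (nrow U ` H)" "z \<in> H" "nbrs H z = {}"
  shows "g $ z = 0"
proof -
  have "nrow U h $ z = 0" if "h \<in> H" for h
    using that assms(2-3) sym by (auto simp: nbrs_def)
  then have "nrow U ` H \<subseteq> {g. g $ z = 0}"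
    by auto
  moreover have "subspace {g :: real^'a. g $ z = 0}"
    by (auto simp: subspace_def)
  ultimately show ?thesis
    using assms(1) span_minimal by blast
qed

text \<open>Both sides of this inclusion have dimension \<open>rk U - 1\<close>; this is the source of the rigidity
  of the adjacencies between \<open>S\<close> and the twins in \<open>H\<close>.\<close>
lemma span_rows_H:
  assumes "g \<in> span (nrow U ` U)" "g $ x = g $ y"
  shows "g \<in> span (nrow U ` H)"
proof -
  define A where "A = {g \<in> span (nrow U ` U). g $ x = g $ y}"
  have A: "subspace A"
    using subspace_span[of "nrow U ` U"] by (auto simp: A_def subspace_def)
  have sub: "span (nrow U ` H) \<subseteq> A"
  proof
    fix g assume g: "g \<in> span (nrow U ` H)"
    then have "g \<in> span (nrow U ` U)"
      using span_mono[OF image_mono[OF HU, of "nrow U"]] by blast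
    then show "g \<in> A"
      using twins_coordinate[OF g xy(1,2,4)] by (simp add: A_def)
  qed
  obtain s where s: "s \<in> S"
    using S_nonempty by blast
  have sx: "nrow U s $ x \<noteq> nrow U s $ y"
    using S_xy[OF s] xy HU sym[of s x] sym[of s y] by auto
  have "nrow U s \<in> span (nrow U ` U)"
    using s SU by (auto intro!: span_base)
  moreover have "nrow U s \<notin> A"
    using sx by (simp add: A_def)
  moreover have "A \<subseteq> span (nrow U ` U)"
    by (auto simp: A_def)
  ultimately have "A \<subset> span (nrow U ` U)"
    by blast
  then have "dim A < rk U"
    unfolding subrank_def by (metis A dim_psubset dim_span span_eq_iff)
  moreover have "rk H + 1 \<le> subrank H U"
  proof (rule subrank_less[OF HU])
    show "nrow U x - nrow U y \<in> span (nrow U ` H)"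
      using xy(1,2) by (intro span_diff) (auto intro: span_base)
    have "(nrow U x - nrow U y) $ s \<noteq> 0"
      using S_xy[OF s] s SU by auto
    then show "nrow U x - nrow U y \<noteq> 0"
      by (metis zero_index)
    show "(nrow U x - nrow U y) $ i = 0" if "i \<in> H" for i
      using that xy(4) by (auto simp: nbrs_eq_iff)
  qed
  ultimately have "dim A \<le> dim (span (nrow U ` H))"
    using rk_eq by (simp add: subrank_def)
  then have "span (nrow U ` H) = A"
    using subspace_dim_equal[OF subspace_span A sub] by simp
  then show ?thesis
    using assms by (simp add: A_def)
qed

lemma nrow_S: "s \<in> S \<Longrightarrow> nrow U s \<in> span (nrow U ` U)"
  using SU by (auto intro!: span_base)

lemma nrow_S_xy: "s \<in> S \<Longrightarrow> nrow U s $ x = of_bool (E x s)" "s \<in> S \<Longrightarrow> nrow U s $ y = of_bool (\<not> E x s)"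
  using S_xy xy HU sym[of s x] sym[of s y] by auto

text \<open>The side of a vertex of \<open>S\<close> is its adjacency to \<open>x\<close>;
  \<open>y\<close> sees the opposite. On the same side the difference of rows is zero at both
  \<open>x\<close> and \<open>y\<close>; on opposite sides the sum is one at both.\<close>

lemma same_side:
  assumes "s \<in> S" "s' \<in> S" "E x s \<longleftrightarrow> E x s'"
  shows "nrow U s - nrow U s' \<in> span (nrow U ` H)"
  by (rule span_rows_H) (use assms in \<open>auto intro!: span_diff nrow_S simp: nrow_S_xy simp del: nrow_nth\<close>)

lemma opposite_side:
  assumes "s \<in> S" "s' \<in> S" "E x s \<noteq> E x s'"
  shows "nrow U s + nrow U s' \<in> span (nrow U ` H)"
  by (rule span_rows_H) (use assms in \<open>auto intro!: span_add nrow_S simp: nrow_S_xy simp del: nrow_nth\<close>)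

text \<open>Vectors in the span of the rows of \<open>H\<close> take equal values at
  \<open>u\<close> and \<open>v\<close>, while each row of \<open>S\<close> takes opposite values
  there. Applied to the difference or sum of two rows of \<open>S\<close>, this carries the sides
  over from \<open>x\<close> to \<open>u\<close>.\<close>

lemma twins_sides:
  assumes uv: "u \<in> H" "v \<in> H" "u \<noteq> v" "nbrs H u = nbrs H v" and s: "s \<in> S" "s' \<in> S"
  shows "(E u s \<longleftrightarrow> E u s') \<longleftrightarrow> (E x s \<longleftrightarrow> E x s')"
proof -
  have row: "nrow U a $ u = of_bool (E u a)" "nrow U a $ v = of_bool (\<not> E u a)" if "a \<in> S" for a
    using twins_S[OF uv that] uv(1,2) HU sym[of a] by auto
  show ?thesis
  proof (cases "E x s \<longleftrightarrow> E x s'")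
    case True
    then have "(nrow U s - nrow U s') $ u = (nrow U s - nrow U s') $ v"
      using twins_coordinate same_side s uv by blast
    then show ?thesis
      using True row[OF s(1)] row[OF s(2)]
      by (cases "E u s"; cases "E u s'") (simp_all del: nrow_nth)
  next
    case False
    then have "(nrow U s + nrow U s') $ u = (nrow U s + nrow U s') $ v"
      using twins_coordinate opposite_side s uv by blast
    then show ?thesis
      using False row[OF s(1)] row[OF s(2)]
      by (cases "E u s"; cases "E u s'") (simp_all del: nrow_nth)
  qed
qed

text \<open>On opposite sides the sum of the two rows would have to vanish at \<open>z\<close>, yet
  both rows are one there.\<close>

lemma isolated_sides:
  assumes "z \<in> H" "nbrs H z = {}" "s \<in> S" "s' \<in> S"
  shows "E x s \<longleftrightarrow> E x s'"
proof (rule ccontr)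
  assume "\<not> ?thesis"
  then have "(nrow U s + nrow U s') $ z = 0"
    using isolated_coordinate opposite_side assms by blast
  moreover have "E s z" "E s' z"
    using isolated_nbrs[OF assms(1,2)] assms(3,4) sym by (auto simp: nbrs_def)
  ultimately show False
    using assms(1) HU by auto
qed

section \<open>Twin pairs, single vertices and the isolated vertex\<close>

definition "X = {v \<in> H. nbrs H v \<noteq> {} \<and> (\<exists>w\<in>H. w \<noteq> v \<and> nbrs H w = nbrs H v)}"
definition "Singles = {v \<in> H. nbrs H v \<noteq> {} \<and> (\<forall>w\<in>H. nbrs H w = nbrs H v \<longrightarrow> w = v)}"
definition "Z = {v \<in> H. nbrs H v = {}}"

lemma H_parts: "H = X \<union> Singles \<union> Z"
  by (auto simp: X_def Singles_def Z_def)

lemma card_Z: "card Z \<le> 1"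
  using card_isolated_le by (simp add: Z_def)

lemma same_side_agree:
  assumes s: "s \<in> S" "s' \<in> S" "E x s \<longleftrightarrow> E x s'" and v: "v \<in> X \<union> Z"
  shows "E s v \<longleftrightarrow> E s' v"
proof (cases "v \<in> X")
  case True
  then obtain w where "w \<in> H" "w \<noteq> v" "nbrs H w = nbrs H v" "v \<in> H"
    by (auto simp: X_def)
  then show ?thesis
    using twins_sides[of v w s s'] s sym by metis
next
  case False
  then have "nbrs U v = S"
    using v isolated_nbrs by (auto simp: Z_def)
  then show ?thesis
    using s(1,2) sym by (auto simp: nbrs_def)
qed

lemma same_side_singles:
  assumes s: "s \<in> S" "s' \<in> S" "E x s \<longleftrightarrow> E x s'" and agree: "\<And>v. v \<in> Singles \<Longrightarrow> E s v \<longleftrightarrow> E s' v"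
  shows "s = s'"
proof (rule ccontr)
  assume ne: "s \<noteq> s'"
  have agreeH: "E s v \<longleftrightarrow> E s' v" if "v \<in> H" for v
    using that H_parts same_side_agree[OF s] agree by blast
  txt \<open>The form of the adjacency matrix vanishes at \<open>s - s'\<close>, where it takes the value \<open>-2\<close> on an edge.\<close>
  have "nrow U ` H \<subseteq> {g. g $ s = g $ s'}"
    using agreeH sym s(1,2) SU by auto
  moreover have "subspace {g :: real^'a. g $ s = g $ s'}"
    by (auto simp: subspace_def)
  ultimately have "(nrow U s - nrow U s') $ s = (nrow U s - nrow U s') $ s'"
    using same_side[OF s] span_minimal by blast
  then have nadj: "\<not> E s s'"
    using subsetD[OF SU s(1)] subsetD[OF SU s(2)] sym[of s' s] by (cases "E s s'") simp_all
  \<comment> \<open>The two rows differ only inside \<open>S\<close>, hence on all of it, also at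
    \<open>s\<close> itself; that would make \<open>s\<close> and \<open>s'\<close>
    adjacent.\<close>
  have sub: "nbr_diff U s s' \<subseteq> S"
    using agreeH by (auto simp: nbr_diff_def S_def)
  have "nbr_diff U s s' = S"
    by (rule nbr_diff_eq_S) (use s SU ne sub in auto)
  then have "s \<in> nbr_diff U s s'"
    using s(1) by simp
  then show False
    using nadj sym[of s' s] by (simp add: nbr_diff_def)
qed

text \<open>Kernel of the restriction of the row space of \<open>H\<close> to the columns
  \<open>X\<close>. It contains the differences on \<open>H\<close> of rows from one side of
  \<open>S\<close>, so its dimension both limits \<open>card S\<close> and measures the rank lost in
  passing to \<open>X\<close>.\<close>

definition "Q = {g \<in> span (nrow H ` H). \<forall>v\<in>X. g $ v = 0}"

lemma subspace_Q: "subspace Q"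
  using subspace_span[of "nrow H ` H"] by (auto simp: Q_def subspace_def)

lemma XH: "X \<subseteq> H"
  by (auto simp: X_def)

lemma rk_X: "rk X + dim Q \<le> rk H"
proof -
  have "dim (restr X ` nrow H ` H) + dim Q \<le> dim (nrow H ` H)"
    by (rule dim_image_add_kernel_le[OF linear_restr subspace_Q])
      (auto simp: Q_def restr_def vec_eq_iff)
  then have "subrank H X + dim Q \<le> rk H"
    by (simp add: subrank_def restr_image_nrow[OF XH])
  then show ?thesis
    using subrank_mono[OF XH order_refl, of X] by linarith
qed

lemma card_side_le: "card {s \<in> S. E x s \<longleftrightarrow> \<beta>} \<le> 2 ^ dim Q"
proof -
  define T where "T = {s \<in> S. E x s \<longleftrightarrow> \<beta>}"
  have T: "s \<in> S" "s' \<in> S" "E x s \<longleftrightarrow> E x s'" if "s \<in> T" "s' \<in> T" for s s'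
    using that by (auto simp: T_def)
  have inj: "inj_on (nrow H) T"
  proof (rule inj_onI)
    fix s s' assume st: "s \<in> T" "s' \<in> T" and eq: "nrow H s = nrow H s'"
    have "E s v \<longleftrightarrow> E s' v" if "v \<in> Singles" for v
      using eq that by (auto simp: nrow_eq_iff nbrs_def Singles_def)
    then show "s = s'"
      using same_side_singles T[OF st] by blast
  qed
  have "card (nrow H ` T) \<le> 2 ^ dim Q"
  proof (rule card_01_vectors_le[OF _ _ subspace_Q order_refl])
    fix g h assume "g \<in> nrow H ` T" "h \<in> nrow H ` T"
    then obtain s s' where st: "s \<in> T" "s' \<in> T" "g = nrow H s" "h = nrow H s'"
      by blast
    have "restr H (nrow U s - nrow U s') \<in> restr H ` span (nrow U ` H)"
      using same_side[OF T[OF st(1,2)]] by blast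
    also have "restr H ` span (nrow U ` H) = span (nrow H ` H)"
      by (simp add: linear_span_image[OF linear_restr, symmetric] restr_image_nrow[OF HU])
    also have "restr H (nrow U s - nrow U s') = g - h"
      using st(3,4) by (simp add: linear_diff[OF linear_restr] restr_nrow[OF HU])
    finally have "g - h \<in> span (nrow H ` H)" .
    moreover have "(g - h) $ v = 0" if "v \<in> X" for v
      using same_side_agree[OF T[OF st(1,2)], of v] that st(3,4) XH by auto
    ultimately show "g - h \<in> Q"
      by (simp add: Q_def)
  qed auto
  then show ?thesis
    using card_image[OF inj] by (simp add: T_def)
qed

lemma card_S_sides: "card S \<le> card {s \<in> S. E x s \<longleftrightarrow> True} + card {s \<in> S. E x s \<longleftrightarrow> False}"
proof -
  have "{s \<in> S. E x s \<longleftrightarrow> True} \<union> {s \<in> S. E x s \<longleftrightarrow> False} = S"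
    by auto
  then show ?thesis
    using card_Un_le[of "{s \<in> S. E x s \<longleftrightarrow> True}" "{s \<in> S. E x s \<longleftrightarrow> False}"] by metis
qed

lemma card_S_le_dim_Q: "card S \<le> 2 * 2 ^ dim Q"
  using card_S_sides card_side_le[of True] card_side_le[of False] by linarith

text \<open>An isolated vertex of \<open>H\<close> forces \<open>S\<close> onto one side, which
  saves the factor two and makes up for the extra vertex when \<open>dim Q = 0\<close>.\<close>

lemma card_S_isolated:
  assumes "Z \<noteq> {}"
  shows "card S \<le> 2 ^ dim Q"
proof -
  obtain z s where z: "z \<in> H" "nbrs H z = {}" and s: "s \<in> S"
    using assms S_nonempty by (auto simp: Z_def)
  have "{s' \<in> S. E x s' \<longleftrightarrow> E x s} = S"
    using isolated_sides[OF z _ s] by blast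
  then show ?thesis
    using card_side_le[of "E x s"] by simp
qed

text \<open>One vertex of each twin pair, the one joined to \<open>S\<close> as \<open>x\<close>
  is.\<close>

definition "X0 = {v \<in> X. \<forall>s\<in>S. E v s \<longleftrightarrow> E x s}"

lemma X_side:
  assumes "v \<in> X" "v \<notin> X0" "s \<in> S"
  shows "E v s \<longleftrightarrow> \<not> E x s"
proof -
  obtain w where w: "w \<in> H" "w \<noteq> v" "nbrs H w = nbrs H v" "v \<in> H"
    using assms(1) by (auto simp: X_def)
  obtain s' where "s' \<in> S" "E v s' \<noteq> E x s'"
    using assms(1,2) by (auto simp: X0_def)
  then show ?thesis
    using twins_sides[of v w s s'] w assms(3) by auto
qed

lemma twins_not_same_side:
  assumes "u \<in> X" "v \<in> X" "nbrs H u = nbrs H v" "u \<in> X0 \<longleftrightarrow> v \<in> X0"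
  shows "u = v"
proof (rule ccontr)
  assume ne: "u \<noteq> v"
  obtain s where s: "s \<in> S"
    using S_nonempty by blast
  have "E v s \<longleftrightarrow> \<not> E u s"
    using twins_S[of u v s] assms(1-3) ne s XH by blast
  moreover have "E u s \<longleftrightarrow> E v s"
    using X_side[OF assms(1) _ s] X_side[OF assms(2) _ s] assms(4) s by (auto simp: X0_def)
  ultimately show False
    by blast
qed

lemma partner:
  assumes "v \<in> X" "v \<notin> X0"
  obtains w where "w \<in> X0" "nbrs H w = nbrs H v"
proof -
  obtain w where w: "w \<in> H" "w \<noteq> v" "nbrs H w = nbrs H v"
    using assms(1) by (auto simp: X_def)
  then have wX: "w \<in> X"
    using assms(1) unfolding X_def by (metis (mono_tags, lifting) mem_Collect_eq)
  then have "w \<in> X0"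
    using twins_not_same_side[OF wX assms(1) w(3)] w(2) assms(2) by blast
  then show thesis
    using that w by blast
qed

lemma card_X: "card X \<le> 2 * card X0"
proof -
  have inj: "inj_on (nbrs H) X0" "inj_on (nbrs H) (X - X0)"
    using twins_not_same_side by (auto simp: inj_on_def X0_def)
  have "nbrs H ` (X - X0) \<subseteq> nbrs H ` X0"
    using partner by (metis DiffD1 DiffD2 image_eqI image_subsetI)
  then have "card (X - X0) \<le> card X0"
    using card_mono[of "nbrs H ` X0" "nbrs H ` (X - X0)"] by (simp add: card_image[OF inj(1)] card_image[OF inj(2)])
  moreover have "card X = card X0 + card (X - X0)"
    by (metis (no_types, lifting) X0_def card_Un_disjoint Diff_disjoint Un_Diff_cancel finite mem_Collect_eq subsetI sup.absorb2)
  ultimately show ?thesis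
    by simp
qed

lemma card_X0_Singles: "card X0 + card Singles \<le> card (nbrs H ` {v \<in> H. nbrs H v \<noteq> {}})"
proof -
  have X0X: "X0 \<subseteq> X"
    by (auto simp: X0_def)
  have disj: "X0 \<inter> Singles = {}"
    by (auto simp: X0_def X_def Singles_def)
  have inj: "inj_on (nbrs H) (X0 \<union> Singles)"
  proof (rule inj_onI)
    fix u v assume *: "u \<in> X0 \<union> Singles" "v \<in> X0 \<union> Singles" "nbrs H u = nbrs H v"
    show "u = v"
    proof (cases "u \<in> X0 \<and> v \<in> X0")
      case True
      then show ?thesis
        using twins_not_same_side * X0X by blast
    next
      case False
      then have "u \<in> Singles \<or> v \<in> Singles" "u \<in> H" "v \<in> H"
        using * X0X XH by (auto simp: Singles_def)
      then show ?thesis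
        using *(3) by (auto simp: Singles_def)
    qed
  qed
  have "card X0 + card Singles = card (nbrs H ` (X0 \<union> Singles))"
    using disj by (simp add: card_image[OF inj] card_Un_disjoint)
  also have "\<dots> \<le> card (nbrs H ` {v \<in> H. nbrs H v \<noteq> {}})"
    using X0X by (intro card_mono image_mono) (auto simp: X_def Singles_def)
  finally show ?thesis .
qed

lemma card_U_le: "card U \<le> card S + card Z + 2 * card X0 + card Singles"
proof -
  have "card H \<le> card X + card Singles + card Z"
    using card_Un_le[of "X \<union> Singles" Z] card_Un_le[of X Singles] unfolding H_parts[symmetric] by linarith
  then show ?thesis
    using card_U card_X by linarith
qed

text \<open>Vertices of \<open>X0\<close> that agree on \<open>X0\<close> also agree on the twins of
  its members, on \<open>Z\<close> and on \<open>S\<close>. They can differ only on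
  \<open>Singles\<close>, which is smaller than the minimum distance \<open>card S\<close>.\<close>

lemma inj_nbrs_X0:
  assumes "card Singles < card S"
  shows "inj_on (nbrs X0) X0"
proof (rule inj_onI, rule ccontr)
  fix u v assume *: "u \<in> X0" "v \<in> X0" "nbrs X0 u = nbrs X0 v" "u \<noteq> v"
  have uvH: "u \<in> H" "v \<in> H" 
    using * XH by (auto simp: X0_def)
  have agree: "E u w \<longleftrightarrow> E v w" if w: "w \<in> U - Singles" for w
  proof -
    consider "w \<in> X0" | "w \<in> X" "w \<notin> X0" | "w \<in> Z" | "w \<in> S"
      using w H_parts by (auto simp: S_def)
    then show ?thesis
    proof cases
      case 1
      then show ?thesis
        using *(3) by (auto simp: nbrs_def)
    next
      case 2
      then obtain w' where w': "w' \<in> X0" "nbrs H w' = nbrs H w"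
        using partner by blast
      have "E u w' \<longleftrightarrow> E v w'"
        using w'(1) *(3) by (auto simp: nbrs_def)
      moreover have "E a w \<longleftrightarrow> E a w'" if "a \<in> H" for a
        using that w'(2) sym by (auto simp: nbrs_def)
      ultimately show ?thesis
        using uvH by blast
    next
      case 3
      then show ?thesis
        using uvH sym by (auto simp: Z_def nbrs_def)
    next
      case 4
      then show ?thesis
        using *(1,2) by (auto simp: X0_def)
    qed
  qed
  have "nbr_diff U u v \<subseteq> Singles"
    using agree by (auto simp: nbr_diff_def)
  then have "card (nbr_diff U u v) \<le> card Singles"
    by (simp add: card_mono)
  then show False
    using card_S_le_nbr_diff[of u v] uvH HU *(4) assms by fastforce
qed

end

section \<open>The induction\<close>

text \<open>\<open>7072 / 10000\<close> is a rational just above \<open>1 / sqrt 2\<close>.\<close>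

lemma order_bound_le_Suc: "order_bound r \<le> 7072 / 10000 * order_bound (r + 1)"
proof -
  have "14142 / 10000 \<le> sqrt 2"
    by (rule real_le_rsqrt) (simp add: power2_eq_square)
  then have "14142 / 10000 * order_bound r \<le> sqrt 2 * order_bound r"
    by (intro mult_right_mono) (auto simp: order_bound_def)
  also have "\<dots> = order_bound (r + 1)"
    by (simp add: order_bound_def)
  finally show ?thesis
    by (simp add: order_bound_def)
qed

lemma order_bound_ge: "10 * 2 ^ ((r + 1) div 2) \<le> order_bound r"
proof -
  have "2 ^ ((r + 1) div 2) = sqrt 2 ^ (2 * ((r + 1) div 2))"
    by (simp add: power_mult)
  also have "\<dots> \<le> sqrt 2 ^ (r + 1)"
    by (intro power_increasing) auto
  finally show ?thesis
    by (simp add: order_bound_def)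
qed

lemma (in maximal_deficient) card_S_upper:
  assumes r: "8 \<le> rk U" and n: "order_bound (rk U) < real (card U) + 2"
  shows "32 * card S \<le> 9 * card U"
proof -
  define r where "r = rk U"
  \<comment> \<open>This choice leaves at most half of the energy, while \<open>2 ^ k\<close> is at
    most \<open>n / 9\<close> because \<open>10 * 2 ^ k \<le> order_bound r < n + 2\<close>. Then
    \<open>n - 2 ^ k\<close> is at least \<open>8 / 9 * n\<close>, whence the factor
    \<open>9 / 32\<close>.\<close>
  define k where "k = (r + 1) div 2"
  define n where "n = real (card U)"
  define t where "t = real (card S)"
  have k: "k \<le> r" "2 * real (r - k) \<le> real r" "4 \<le> k"
    using r by (auto simp: k_def r_def)
  have "(2::real) \<le> 2 ^ k"
    using power_increasing[of 1 k "2::real"] k(3) by simp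
  then have nk: "9 * 2 ^ k \<le> n"
    using n order_bound_ge[of r] by (simp add: n_def r_def k_def)
  have "2 * real r * t * (n - 2 ^ k) \<le> real (r - k) * n * n"
    unfolding r_def t_def n_def
    by (rule min_distance_le) (use r k card_S_le_nbr_diff in \<open>auto simp: r_def\<close>)
  also have "\<dots> \<le> real r / 2 * n * n"
    using k(2) by (intro mult_right_mono) (auto simp: n_def)
  finally have "real r * (4 * t * (n - 2 ^ k)) \<le> real r * (n * n)"
    by simp
  then have *: "4 * t * (n - 2 ^ k) \<le> n * n"
    using r by (simp add: r_def)
  have "4 * t * (8 / 9 * n) \<le> 4 * t * (n - 2 ^ k)"
    using nk by (intro mult_left_mono) (auto simp: t_def)
  with * have "n * (32 * t) \<le> n * (9 * n)"
    by (simp add: algebra_simps)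
  moreover have "0 < n"
    using nk by (meson less_le_trans mult_pos_pos zero_less_numeral zero_less_power)
  ultimately have "32 * t \<le> 9 * n"
    by simp
  then show ?thesis
    by (simp add: t_def n_def)
qed

lemma (in fin_graph) reduced_card_le_step:
  assumes IH: "\<And>U'. reduced U' \<Longrightarrow> rk U' < r \<Longrightarrow> real (card U') + 2 \<le> order_bound (rk U')"
    and U: "reduced U" "rk U = r" and r: "8 \<le> r"
  shows "real (card U) + 2 \<le> order_bound r"
proof (rule ccontr)
  assume "\<not> ?thesis"
  then have big: "order_bound r < real (card U) + 2"
    by simp
  have "rk {} < r"
    using r by (simp add: subrank_def)
  then have "\<exists>H. (H \<subseteq> U \<and> rk H < r) \<and> (\<forall>W. W \<subseteq> U \<and> rk W < r \<longrightarrow> card W \<le> card H)"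
    by (intro ex_has_greatest_nat[of _ "{}" _ "Suc (card U)"]) (auto simp: less_Suc_eq_le intro: card_mono)
  then obtain H where H: "H \<subseteq> U" "rk H < r" "\<And>W. W \<subseteq> U \<Longrightarrow> rk W < r \<Longrightarrow> card W \<le> card H"
    by blast
  interpret maximal_deficient E U H
    by unfold_locales (use U H in auto)
  have upper: "32 * card S \<le> 9 * card U"
    by (rule card_S_upper) (use U r big in auto)
  have n: "158 < real (card U)"
    using big order_bound_ge[of 8] order_bound_mono[OF r] by simp
  have c1: "order_bound (r - 1) \<le> 7072 / 10000 * order_bound r"
    using order_bound_le_Suc[of "r - 1"] r by simp
  have c2: "order_bound r = 2 * order_bound (r - 2)" "order_bound (r - 1) = 2 * order_bound (r - 3)"
    "order_bound (r - 3) = 2 * order_bound (r - 5)"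
    using order_bound_add2[of "r - 2"] order_bound_add2[of "r - 3"] order_bound_add2[of "r - 5"] r
    by (simp_all add: numeral_eq_Suc Suc_diff_Suc)
  \<comment> \<open>Otherwise \<open>n\<close> would be at most
    \<open>9 / 32 * n + 0.7072 * (n + 2)\<close>, which is below \<open>n\<close> for
    \<open>n > 158\<close>.\<close>
  have small_H: False if "real (card H) \<le> order_bound (r - 1)"
    using that upper n c1 big card_U by linarith
  show False
  proof (cases "inj_on (nbrs H) H")
    case True
    have "real (card H) + 1 \<le> order_bound (r - 1)"
      by (rule card_twin_free_le[OF IH]) (use H(2) r True in auto)
    then show False
      using small_H by simp
  next
    case False
    then obtain x y where xy: "x \<in> H" "y \<in> H" "x \<noteq> y" "nbrs H x = nbrs H y"
      by (auto simp: inj_on_def)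
    then have "rk H + 2 \<le> r"
      using twins_rk U by metis
    show False
    proof (cases "rk H + 2 = r")
      case False
      \<comment> \<open>Pairing at most doubles \<open>order_bound (r - 3)\<close>, which only gives
        \<open>order_bound (r - 1)\<close>.\<close>
      then have "rk H \<le> r - 3"
        using \<open>rk H + 2 \<le> r\<close> by simp
      have "real (card (nbrs H ` {v \<in> H. nbrs H v \<noteq> {}})) + 2 \<le> order_bound (r - 3)"
        by (rule card_classes_le[OF IH]) (use \<open>rk H \<le> r - 3\<close> r in auto)
      then show False
        using card_H_le small_H c2(2) by simp
    next
      case True
      interpret twin_extremal E U H x y
        by unfold_locales (use xy True U in auto)
      define q where "q = dim Q"
      have "real (card (nbrs H ` {v \<in> H. nbrs H v \<noteq> {}})) + 2 \<le> order_bound (r - 2)"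
        by (rule card_classes_le[OF IH]) (use True r in auto)
      then have classes: "real (card X0 + card Singles) + 2 \<le> order_bound (r - 2)"
        using card_X0_Singles by linarith
      \<comment> \<open>Let a, b, t, z be the sizes of \<open>X0\<close>, \<open>Singles\<close>,
        \<open>S\<close>, \<open>Z\<close>. Then \<open>n \<le> 2 * (a + b) + (t + z - b)\<close>,
        and the first term is at most \<open>order_bound r - 4\<close>, so \<open>big\<close> forces
        \<open>t + z - b\<close> to be at least 3.\<close>
      have tb: "card Singles + 3 \<le> card S + card Z"
      proof (rule ccontr)
        assume "\<not> ?thesis"
        then show False
          using card_U_le classes c2(1) big by linarith
      qed
      have b: "card Singles < card S"
        using tb card_Z by linarith
      have n_le: "card U \<le> 2 * card S + 2 * card X0"
        using card_U_le tb card_Z by linarith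
      have rkX0: "rk X0 + q \<le> r - 2"
        using rk_X subrank_mono[of X0 X X0 X] True by (auto simp: q_def X0_def)
      consider "q = 0" | "1 \<le> q" "q \<le> 2" | "3 \<le> q"
        by linarith
      then show False
      proof cases
        case 1
        \<comment> \<open>Either way \<open>card S + card Z \<le> 2\<close>, contrary to
          \<open>tb\<close>.\<close>
        then have "card S \<le> 2" "Z \<noteq> {} \<Longrightarrow> card S \<le> 1"
          using card_S_le_dim_Q[folded q_def] card_S_isolated[folded q_def] by simp_all
        then show False
          using tb card_Z by (cases "Z = {}") auto
      next
        case 2
        \<comment> \<open>Here \<open>n \<le> 16 + 2 * card X0\<close>, at most a constant above
          \<open>order_bound (r - 1)\<close>.\<close>
        have "real (card X0) + 1 \<le> order_bound (r - 3)"
          by (rule card_twin_free_le[OF IH _ _ inj_nbrs_X0[OF b]]) (use rkX0 2 r in auto)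
        moreover have "(2::nat) ^ q \<le> 2 ^ 2"
          using 2 by (intro power_increasing) auto
        then have "card S \<le> 8"
          using card_S_le_dim_Q by (simp add: q_def)
        ultimately show False
          using n_le c2(2) c1 big n by linarith
      next
        case 3
        \<comment> \<open>Now \<open>2 * card X0\<close> is below
          \<open>order_bound (r - 1) / 2\<close>, about \<open>0.36 * n\<close> at most, and
          \<open>2 * card S\<close> is at most \<open>9 / 16 * n\<close>.\<close>
        have "real (card X0) + 1 \<le> order_bound (r - 5)"
          by (rule card_twin_free_le[OF IH _ _ inj_nbrs_X0[OF b]]) (use rkX0 3 r in auto)
        then show False
          using n_le upper c2(2,3) c1 big n by linarith
      qed
    qed
  qed
qed

lemma (in fin_graph) reduced_card_le_order_bound:
  assumes "reduced U"
  shows "real (card U) + 2 \<le> order_bound (rk U)"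
  using assms
proof (induction "rk U" arbitrary: U rule: less_induct)
  case less
  show ?case
  proof (cases "8 \<le> rk U")
    case True
    show ?thesis
      by (rule reduced_card_le_step[OF less.hyps less.prems refl True])
  next
    case False
    have "real (card U) + 1 \<le> 2 ^ rk U"
      using of_nat_mono[OF reduced_card_le[OF less.prems], where 'a = real] by simp
    moreover have "2 ^ rk U + 1 \<le> order_bound (rk U)"
    proof -
      \<comment> \<open>Ranks up to 6 have \<open>k \<le> 3\<close>, so
        \<open>2 ^ rk U \<le> 4 ^ k \<le> 8 * 2 ^ k\<close>; rank 7 amounts to
        \<open>129 \<le> 160\<close>.\<close>
      define k where "k = (rk U + 1) div 2"
      have "rk U \<le> 2 * k" "k \<le> 3 \<or> (k = 4 \<and> rk U = 7)"
        using False by (auto simp: k_def)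
      show ?thesis
      proof (cases "k \<le> 3")
        case True
        have "(2::real) ^ rk U \<le> 2 ^ (k + k)"
          using \<open>rk U \<le> 2 * k\<close> by (intro power_increasing) auto
        also have "\<dots> = 2 ^ k * 2 ^ k"
          by (rule power_add)
        also have "\<dots> \<le> 2 ^ 3 * 2 ^ k"
          using True by (intro mult_right_mono power_increasing) auto
        finally have "(2::real) ^ rk U \<le> 8 * 2 ^ k"
          by simp
        moreover have "(1::real) \<le> 2 ^ k"
          by simp
        ultimately show ?thesis
          using order_bound_ge[of "rk U", folded k_def] by linarith
      next
        case False
        then show ?thesis
          using \<open>k \<le> 3 \<or> (k = 4 \<and> rk U = 7)\<close> order_bound_ge[of "rk U"] by (simp add: k_def)
      qed
    qed
    ultimately show ?thesis
      by linarith
  qed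
qed

text \<open>Equality holds for odd \<open>r\<close>; for even \<open>r\<close> the comparison is
  \<open>10 * sqrt 2 \<le> 16\<close>.\<close>

lemma order_bound_le_m'_order:
  assumes "2 \<le> r"
  shows "order_bound r \<le> real_of_int (m'_order r) + 2"
proof (cases "even r")
  case True
  then obtain k where k: "r = 2 * k"
    by blast
  have "sqrt 2 \<le> 16 / 10"
    by (rule real_le_lsqrt) (auto simp: power2_eq_square)
  then have "10 * (2 ^ k * sqrt 2) \<le> 16 * (2::real) ^ k"
    by simp
  moreover have "order_bound r = 10 * (2 ^ k * sqrt 2)"
    by (simp add: order_bound_def k power_mult)
  moreover have "m'_order r = 16 * 2 ^ k - 2"
    by (simp add: m'_order_def m_order_def k)
  ultimately show ?thesis
    by simp
next
  case False
  then obtain k where k: "r = 2 * k + 1"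
    by (elim oddE)
  then obtain j where j: "k = Suc j"
    using assms by (cases k) auto
  have "order_bound r = 10 * sqrt 2 ^ (2 * (k + 1))"
    by (simp add: order_bound_def k)
  then have "order_bound r = 10 * 2 ^ (k + 1)"
    by (simp only: power_mult) simp
  moreover have "m'_order r = 40 * 2 ^ j - 2"
    by (simp add: m'_order_def m_order_def k j)
  ultimately show ?thesis
    by (simp add: j)
qed

theorem theorem4p9:
  fixes r :: nat and E :: "'v::finite \<Rightarrow> 'v \<Rightarrow> bool"
  assumes "r \<ge> 2"
    and "simple_graph E"
    and "reduced_graph E"
    and "graph_rank E = r"
  shows "int (CARD('v)) \<le> m'_order r"
proof -
  interpret fin_graph E
    using assms(2) by unfold_locales (auto simp: simple_graph_def irreflp_def dest: sympD)
  have "nbrs UNIV = neighbors E"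
    by (auto simp: nbrs_def neighbors_def)
  then have "reduced UNIV"
    using assms(3) by (auto simp: reduced_def reduced_graph_def inj_on_def)
  moreover have "row u (adjacency_matrix E) = nrow UNIV u" for u
    by (simp add: row_def adjacency_matrix_def vec_eq_iff of_bool_def)
  then have "rows (adjacency_matrix E) = range (nrow UNIV)"
    by (auto simp: rows_def)
  then have "rk UNIV = r"
    using assms(4) by (simp add: graph_rank_def row_rank_def subrank_def)
  ultimately have "real CARD('v) + 2 \<le> order_bound r"
    using reduced_card_le_order_bound by fastforce
  then have "real CARD('v) \<le> real_of_int (m'_order r)"
    using order_bound_le_m'_order[OF assms(1)] by linarith
  then show ?thesis
    by linarith
qed

end
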